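(* Let $A$ be a commutative Noetherian ring with identity and let $n$ be a positive integer. Then the ring of formal power series $A[[x_1,\ldots,x_n]]$ in $n$ variables over $A$ is Noetherian.
   Context: A commutative ring with identity is Noetherian if every ideal of it is finitely generated. *)

theory Defs
  imports "HOL-Algebra.Ring_Divisibility" "HOL-Library.Multiset"
begin

text \<open>
  As in \<open>HOL-Algebra.Indexed_Polynomials\<close>, a monomial is the multiset of its variables:
  \<open>x\<^sub>1\<^bsup>a1\<^esup> \<dots> x\<^sub>n\<^bsup>an\<^esup>\<close> is the multiset in which \<open>i\<close> has multiplicity \<open>ai\<close>, so that the product of
  monomials is \<open>+\<close> and divisibility is \<open>\<subseteq>#\<close>.
\<close>

definition monomials :: "nat \<Rightarrow> nat multiset set"
  where "monomials n = {m. set_mset m \<subseteq> {1..n}}"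

text \<open>
  \<open>mfps_ring A n\<close> is \<open>A[[x\<^sub>1, \<dots>, x\<^sub>n]]\<close>. A power series is the family of its coefficients, with no
  finiteness condition on its support; it is \<open>undefined\<close> outside \<open>monomials n\<close>, so that equality of
  series is equality of coefficients. Multiplication is the Cauchy product, a finite sum over the
  factorizations \<open>m = k + (m - k)\<close> of the monomial \<open>m\<close>.
\<close>

definition mfps_ring :: "('a, 'b) ring_scheme \<Rightarrow> nat \<Rightarrow> (nat multiset \<Rightarrow> 'a) ring"
  where "mfps_ring A n = \<lparr>
    carrier = monomials n \<rightarrow>\<^sub>E carrier A,
    mult = (\<lambda>f g. \<lambda>m\<in>monomials n. \<Oplus>\<^bsub>A\<^esub>k\<in>{k. k \<subseteq># m}. f k \<otimes>\<^bsub>A\<^esub> g (m - k)),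
    one = (\<lambda>m\<in>monomials n. if m = {#} then \<one>\<^bsub>A\<^esub> else \<zero>\<^bsub>A\<^esub>),
    zero = (\<lambda>m\<in>monomials n. \<zero>\<^bsub>A\<^esub>),
    add = (\<lambda>f g. \<lambda>m\<in>monomials n. f m \<oplus>\<^bsub>A\<^esub> g m)\<rparr>"

end

theory Submission
  imports Defs
begin

text \<open>
  The engine is a completeness criterion: if \<open>R\<close> is \<open>x\<close>-adically complete and \<open>R/xR\<close> is Noetherian,
  then \<open>R\<close> is Noetherian. For an ideal \<open>I\<close>, the images in \<open>R/xR\<close> of the colon ideals
  \<open>J\<^sub>k = (I : x\<^sup>k)\<close> form an ascending chain, which stabilises at some \<open>N\<close>. Lift finitely many generators
  of the image of \<open>J\<^sub>N\<close> to \<open>T \<subseteq> J\<^sub>N\<close>; each element of \<open>J\<^sub>N\<^sub>+\<^sub>k\<close> is a combination of \<open>T\<close> plus \<open>x\<close>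
  times an element of \<open>J\<^sub>N\<^sub>+\<^sub>k\<^sub>+\<^sub>1\<close>, and summing the resulting \<open>x\<close>-adic series shows that \<open>T\<close> generates
  \<open>J\<^sub>N\<close>. Generators of \<open>J\<^sub>k\<^sub>+\<^sub>1\<close> times \<open>x\<close>, together with lifted generators of the image of \<open>J\<^sub>k\<close>,
  generate \<open>J\<^sub>k\<close>, so finite generation descends to \<open>J\<^sub>0 = I\<close>. The theorem follows by induction on \<open>n\<close>,
  with \<open>x = x\<^sub>n\<^sub>+\<^sub>1\<close> and \<open>A[[x\<^sub>1, \<dots>, x\<^sub>n\<^sub>+\<^sub>1]]/(x\<^sub>n\<^sub>+\<^sub>1) = A[[x\<^sub>1, \<dots>, x\<^sub>n]]\<close>.
\<close>

section \<open>Noetherian rings and complete principal ideals\<close>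

context cring
begin

text \<open>Negation is multiplication by \<open>\<ominus> \<one>\<close>, so \<open>mult\<close>
  supplies additive inverses; commutativity supplies absorption on the other side.\<close>

lemma cring_idealI:
  assumes sub: "I \<subseteq> carrier R" and zero: "\<zero> \<in> I"
    and add: "\<And>a b. a \<in> I \<Longrightarrow> b \<in> I \<Longrightarrow> a \<oplus> b \<in> I"
    and mult: "\<And>r a. r \<in> carrier R \<Longrightarrow> a \<in> I \<Longrightarrow> r \<otimes> a \<in> I"
  shows "ideal I R"
proof (rule idealI)
  show "ring R" by (rule ring_axioms)
  show "subgroup I (add_monoid R)"
  proof (rule add.subgroupI)
    fix a assume a: "a \<in> I"
    then have "\<ominus> a = (\<ominus> \<one>) \<otimes> a" using sub by (auto simp: l_minus)
    then show "\<ominus> a \<in> I" using mult[OF _ a, of "\<ominus> \<one>"] by simp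
  qed (use assms in auto)
  show "x \<otimes> a \<in> I" "a \<otimes> x \<in> I" if "a \<in> I" "x \<in> carrier R" for a x
    using mult[OF that(2,1)] m_comm[of a x] that sub by auto
qed

text \<open>The ideal quotient (I : x). Iterating it gives (I : x^k) without mentioning powers of
  \<open>x\<close>.\<close>

definition colon :: "'a set \<Rightarrow> 'a \<Rightarrow> 'a set"
  where "colon I x = {f \<in> carrier R. x \<otimes> f \<in> I}"

lemma ideal_colon:
  assumes "ideal I R" and x: "x \<in> carrier R"
  shows "ideal (colon I x) R"
proof -
  interpret ideal I R by fact
  show ?thesis
    by (rule cring_idealI)
      (use x in \<open>auto simp: colon_def r_distr m_lcomm I_l_closed\<close>)
qed

lemma ideal_subset_colon:
  assumes "ideal I R" and "x \<in> carrier R"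
  shows "I \<subseteq> colon I x"
  using ideal.I_l_closed[OF assms(1) _ assms(2)] ideal.Icarr[OF assms(1)] by (auto simp: colon_def)

text \<open>The combinations form an ideal containing \<open>S\<close>, hence containing
  \<open>Idl S\<close>. Indexing the coefficients by \<open>S\<close> itself keeps one fixed index
  set, so that coefficients from successive stages can later be collected generator by
  generator.\<close>

lemma genideal_finite_combination:
  assumes fin: "finite S" and S: "S \<subseteq> carrier R" and y: "y \<in> Idl S"
  obtains c where "c \<in> S \<rightarrow> carrier R" and "y = (\<Oplus>s\<in>S. c s \<otimes> s)"
proof -
  define J where "J = (\<lambda>c. \<Oplus>s\<in>S. c s \<otimes> s) ` (S \<rightarrow> carrier R)"
  have cl: "(\<lambda>s. c s \<otimes> s) \<in> S \<rightarrow> carrier R" if "c \<in> S \<rightarrow> carrier R" for c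
    using that S by auto
  have "ideal J R"
  proof (rule cring_idealI)
    show "J \<subseteq> carrier R" using cl by (auto simp: J_def)
    have "\<zero> = (\<Oplus>s\<in>S. \<zero> \<otimes> s)"
      using S by (subst add.finprod_one_eqI) auto
    then show "\<zero> \<in> J" unfolding J_def by (intro image_eqI[of _ _ "\<lambda>_. \<zero>"]) auto
  next
    fix a b assume "a \<in> J" "b \<in> J"
    then obtain c d where c: "c \<in> S \<rightarrow> carrier R" "a = (\<Oplus>s\<in>S. c s \<otimes> s)"
      and d: "d \<in> S \<rightarrow> carrier R" "b = (\<Oplus>s\<in>S. d s \<otimes> s)" by (auto simp: J_def)
    have "a \<oplus> b = (\<Oplus>s\<in>S. c s \<otimes> s \<oplus> d s \<otimes> s)"
      using cl[OF c(1)] cl[OF d(1)] by (simp add: c(2) d(2))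
    also have "\<dots> = (\<Oplus>s\<in>S. (c s \<oplus> d s) \<otimes> s)"
      using c(1) d(1) S by (intro finsum_cong') (auto simp: l_distr Pi_iff subset_iff)
    finally show "a \<oplus> b \<in> J"
      unfolding J_def using c(1) d(1) by (intro image_eqI[of _ _ "\<lambda>s. c s \<oplus> d s"]) auto
  next
    fix r a assume r: "r \<in> carrier R" and "a \<in> J"
    then obtain c where c: "c \<in> S \<rightarrow> carrier R" "a = (\<Oplus>s\<in>S. c s \<otimes> s)" by (auto simp: J_def)
    have "r \<otimes> a = (\<Oplus>s\<in>S. r \<otimes> (c s \<otimes> s))"
      using cl[OF c(1)] r fin by (simp add: c(2) finsum_rdistr)
    also have "\<dots> = (\<Oplus>s\<in>S. (r \<otimes> c s) \<otimes> s)"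
      using c(1) S r by (intro finsum_cong') (auto simp: m_assoc Pi_iff subset_iff)
    finally show "r \<otimes> a \<in> J"
      unfolding J_def using c(1) r by (intro image_eqI[of _ _ "\<lambda>s. r \<otimes> c s"]) auto
  qed
  moreover have "S \<subseteq> J"
  proof
    fix s assume s: "s \<in> S"
    have "(\<Oplus>t\<in>S. (if s = t then \<one> else \<zero>) \<otimes> t) = (\<Oplus>t\<in>S. if s = t then t else \<zero>)"
      using S by (intro finsum_cong') auto
    also have "\<dots> = s" using finsum_singleton[OF s fin, of "\<lambda>t. t"] S by auto
    finally show "s \<in> J"
      unfolding J_def by (intro image_eqI[of _ _ "\<lambda>t. if s = t then \<one> else \<zero>"]) auto
  qed
  ultimately have "y \<in> J" using genideal_minimal y by blast
  then show thesis using that by (auto simp: J_def)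
qed

end

section \<open>Images of ideals and the completeness criterion\<close>

lemma (in ring_hom_cring) ideal_image:
  assumes surj: "h ` carrier R = carrier S" and "ideal I R"
  shows "ideal (h ` I) S"
proof -
  interpret I: ideal I R by fact
  show ?thesis
  proof (rule S.cring_idealI)
    show "h ` I \<subseteq> carrier S" using I.a_subset by auto
    show "\<zero>\<^bsub>S\<^esub> \<in> h ` I" using hom_zero I.zero_closed by (metis image_eqI)
  next
    fix a b assume "a \<in> h ` I" "b \<in> h ` I"
    then show "a \<oplus>\<^bsub>S\<^esub> b \<in> h ` I"
      by (smt (verit) I.Icarr I.a_closed hom_add image_iff)
  next
    fix r a assume "r \<in> carrier S" "a \<in> h ` I"
    then show "r \<otimes>\<^bsub>S\<^esub> a \<in> h ` I"
      using surj by (smt (verit) I.Icarr I.I_l_closed hom_mult image_iff)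
  qed
qed

text \<open>
  The last two hypotheses say that \<open>R\<close> is complete and separated for the \<open>x\<close>-adic topology: the
  recursion \<open>t\<^sub>j = a\<^sub>j + x t\<^sub>j\<^sub>+\<^sub>1\<close> has the unique solution \<open>t\<^sub>j = \<Sum>\<^sub>i x\<^sup>i a\<^sub>j\<^sub>+\<^sub>i\<close>.
\<close>
lemma (in ring_hom_cring) noetherian_ring_adically_complete:
  assumes noeth: "noetherian_ring S"
    and surj: "h ` carrier R = carrier S"
    and x: "x \<in> carrier R"
    and ker: "\<And>f. f \<in> carrier R \<Longrightarrow> h f = \<zero>\<^bsub>S\<^esub> \<Longrightarrow> \<exists>g\<in>carrier R. f = x \<otimes> g"
    and complete: "\<And>a :: nat \<Rightarrow> 'a. a \<in> UNIV \<rightarrow> carrier R \<Longrightarrow>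
      \<exists>t\<in>UNIV \<rightarrow> carrier R. \<forall>j. t j = a j \<oplus> x \<otimes> t (Suc j)"
    and separated: "\<And>d :: nat \<Rightarrow> 'a. d \<in> UNIV \<rightarrow> carrier R \<Longrightarrow>
      (\<forall>j. d j = x \<otimes> d (Suc j)) \<Longrightarrow> d 0 = \<zero>"
  shows "noetherian_ring R"
proof (rule R.noetherian_ringI)
  interpret N: noetherian_ring S by fact
  \<comment> \<open>The finite generating set of the image ideal lies in the image of
    \<open>J\<close>, so finitely many preimages can be picked inside \<open>J\<close>.\<close>
  have lift: "\<exists>T\<subseteq>J. finite T \<and> h ` J = Idl\<^bsub>S\<^esub> (h ` T)" if JR: "ideal J R" for J
  proof -
    obtain T' where "T' \<subseteq> carrier S" "finite T'" "h ` J = Idl\<^bsub>S\<^esub> T'"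
      using N.finetely_gen[OF ideal_image[OF surj JR]] by blast
    moreover from this have "T' \<subseteq> h ` J" using S.genideal_self by blast
    ultimately show ?thesis using finite_subset_image[of T' h J] by metis
  qed
  \<comment> \<open>By surjectivity \<open>h f\<close> equals \<open>h g\<close> for some
    \<open>g\<close> in \<open>Idl T\<close>. Then \<open>f \<ominus> g\<close> is in the kernel,
    hence a multiple of \<open>x\<close>; it also lies in \<open>K\<close>, which puts the cofactor
    in (K : x).\<close>
  have split: "\<exists>g\<in>Idl T. \<exists>f'\<in>R.colon K x. f = g \<oplus> x \<otimes> f'"
    if K: "ideal K R" and T: "T \<subseteq> K" and f: "f \<in> K" and hf: "h f \<in> Idl\<^bsub>S\<^esub> (h ` T)" for K T f
  proof -
    interpret K: ideal K R by (rule K)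
    have TR: "T \<subseteq> carrier R" using T K.Icarr by blast
    have "Idl\<^bsub>S\<^esub> (h ` T) \<subseteq> h ` (Idl T)"
      using S.genideal_minimal[OF ideal_image[OF surj R.genideal_ideal[OF TR]]] R.genideal_self[OF TR]
      by blast
    with hf obtain g where g: "g \<in> Idl T" "h f = h g" by blast
    have gK: "g \<in> K" using R.genideal_minimal[OF K T] g(1) by blast
    have fR: "f \<in> carrier R" and gR: "g \<in> carrier R" using K.Icarr f gK by auto
    then have "h (f \<ominus> g) = \<zero>\<^bsub>S\<^esub>" using g(2) by (simp add: R.minus_eq S.r_neg)
    then obtain f' where f': "f' \<in> carrier R" "f \<ominus> g = x \<otimes> f'"
      using ker[OF R.minus_closed[OF fR gR]] by blast
    have "f \<ominus> g \<in> K" using f gK by (simp add: R.minus_eq)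
    then have "f' \<in> R.colon K x" using f' by (simp add: R.colon_def)
    moreover have "f = g \<oplus> x \<otimes> f'"
      unfolding f'(2)[symmetric] using fR gR
      by (simp add: R.minus_eq R.a_ac R.r_neg)
    ultimately show ?thesis using g by blast
  qed
  fix I assume I: "ideal I R"
  define J where "J k = ((\<lambda>K. R.colon K x) ^^ k) I" for k
  have J0: "J 0 = I" and JS: "J (Suc k) = R.colon (J k) x" for k by (simp_all add: J_def)
  have J: "ideal (J k) R" for k
    by (induction k) (auto simp: J0 JS I intro: R.ideal_colon x)
  have "J k \<subseteq> J (Suc k)" for k unfolding JS by (rule R.ideal_subset_colon[OF J x])
  then have J_mono: "J k \<subseteq> J l" if "k \<le> l" for k l using lift_Suc_mono_le that by blast
  \<comment> \<open>Ascending chain condition: the union of a nonempty chain of ideals is a member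
    of it. The index of that member is the \<open>N\<close> at which the images stabilise.\<close>
  have "\<Union>(range (\<lambda>k. h ` J k)) \<in> range (\<lambda>k. h ` J k)"
  proof (rule N.ideal_chain_is_trivial)
    have "h ` J k \<subseteq> h ` J l \<or> h ` J l \<subseteq> h ` J k" for k l
      using J_mono[of k l] J_mono[of l k] by (meson image_mono nat_le_linear)
    then show "subset.chain {I. ideal I S} (range (\<lambda>k. h ` J k))"
      by (auto simp: subset_chain_def ideal_image[OF surj J])
  qed auto
  then obtain N where "(\<Union>k. h ` J k) = h ` J N" by (rule rangeE)
  then have N: "h ` J k \<subseteq> h ` J N" for k by blast

  obtain T where T: "T \<subseteq> J N" "finite T" "h ` J N = Idl\<^bsub>S\<^esub> (h ` T)" using lift[OF J] by blast
  have TR: "T \<subseteq> carrier R" using T(1) ideal.Icarr[OF J] by blast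
  \<comment> \<open>The same \<open>T\<close> serves every level \<open>N + k\<close>, because all
    images are contained in that of \<open>J N\<close>.\<close>
  have step: "\<exists>c f'. c \<in> T \<rightarrow> carrier R \<and> f' \<in> J (Suc (N + k)) \<and> f = (\<Oplus>s\<in>T. c s \<otimes> s) \<oplus> x \<otimes> f'"
    if f: "f \<in> J (N + k)" for f k
  proof -
    have "h f \<in> Idl\<^bsub>S\<^esub> (h ` T)" using f N T(3) by blast
    moreover have "T \<subseteq> J (N + k)" using T(1) J_mono[of N "N + k"] by auto
    ultimately obtain g f' where g: "g \<in> Idl T" and "f' \<in> J (Suc (N + k))" and eq: "f = g \<oplus> x \<otimes> f'"
      using split[OF J _ f] unfolding JS by blast
    moreover obtain c where "c \<in> T \<rightarrow> carrier R" "g = (\<Oplus>s\<in>T. c s \<otimes> s)"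
      using R.genideal_finite_combination[OF T(2) TR g] .
    ultimately show ?thesis using eq by blast
  qed
  have top: "J N = Idl T"
  proof
    show "Idl T \<subseteq> J N" by (rule R.genideal_minimal[OF J T(1)])
    show "J N \<subseteq> Idl T"
    proof
      fix f0 assume f0: "f0 \<in> J N"
      \<comment> \<open>Dependent choice of the successive remainders \<open>F k\<close>, starting
        from \<open>f0\<close>. The coefficients stay existential in the relation between neighbours
        and are extracted afterwards.\<close>
      have "\<exists>F. \<forall>k. (F k \<in> J (N + k) \<and> (k = 0 \<longrightarrow> F k = f0)) \<and>
          (\<exists>c. c \<in> T \<rightarrow> carrier R \<and> F k = (\<Oplus>s\<in>T. c s \<otimes> s) \<oplus> x \<otimes> F (Suc k))"
      proof (rule dependent_nat_choice)
        show "\<exists>f. f \<in> J (N + 0) \<and> (0 = 0 \<longrightarrow> f = f0)" using f0 by auto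
        fix f k assume "f \<in> J (N + k) \<and> (k = 0 \<longrightarrow> f = f0)"
        then obtain c f' where "c \<in> T \<rightarrow> carrier R" "f' \<in> J (Suc (N + k))"
          "f = (\<Oplus>s\<in>T. c s \<otimes> s) \<oplus> x \<otimes> f'" using step by blast
        then show "\<exists>f'. (f' \<in> J (N + Suc k) \<and> (Suc k = 0 \<longrightarrow> f' = f0)) \<and>
            (\<exists>c. c \<in> T \<rightarrow> carrier R \<and> f = (\<Oplus>s\<in>T. c s \<otimes> s) \<oplus> x \<otimes> f')"
          by (intro exI[of _ f'] conjI exI[of _ c]) simp_all
      qed
      then obtain F where F: "\<And>k. F k \<in> J (N + k)" "F 0 = f0"
        and "\<forall>k. \<exists>c. c \<in> T \<rightarrow> carrier R \<and> F k = (\<Oplus>s\<in>T. c s \<otimes> s) \<oplus> x \<otimes> F (Suc k)"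
        by blast
      then obtain c where c: "\<And>k. c k \<in> T \<rightarrow> carrier R"
        and Fc: "\<And>k. F k = (\<Oplus>s\<in>T. c k s \<otimes> s) \<oplus> x \<otimes> F (Suc k)"
        using choice[where Q="\<lambda>k c. c \<in> T \<rightarrow> carrier R \<and> F k = (\<Oplus>s\<in>T. c s \<otimes> s) \<oplus> x \<otimes> F (Suc k)"]
        by blast
      have FR: "F k \<in> carrier R" for k using F(1) ideal.Icarr[OF J] by blast
      \<comment> \<open>Completeness is applied to each generator separately: \<open>t s j\<close>
        stands for the sum of x^i \<open>c (j + i) s\<close> over all i.\<close>
      have "\<forall>s\<in>T. \<exists>t. t \<in> UNIV \<rightarrow> carrier R \<and> (\<forall>j. t j = c j s \<oplus> x \<otimes> t (Suc j))"
      proof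
        fix s assume "s \<in> T"
        then have "(\<lambda>j. c j s) \<in> UNIV \<rightarrow> carrier R" using c by auto
        from complete[OF this]
        show "\<exists>t. t \<in> UNIV \<rightarrow> carrier R \<and> (\<forall>j. t j = c j s \<oplus> x \<otimes> t (Suc j))" by blast
      qed
      from bchoice[OF this] obtain t
        where t: "\<And>s. s \<in> T \<Longrightarrow> t s \<in> UNIV \<rightarrow> carrier R"
        and t_eq: "\<And>s j. s \<in> T \<Longrightarrow> t s j = c j s \<oplus> x \<otimes> t s (Suc j)" by blast
      \<comment> \<open>\<open>G\<close> satisfies the same recursion as \<open>F\<close>, but its
        members are visibly combinations of \<open>T\<close>.\<close>
      define G where "G j = (\<Oplus>s\<in>T. t s j \<otimes> s)" for j
      have cl: "t s j \<otimes> s \<in> carrier R" "c j s \<otimes> s \<in> carrier R" if s: "s \<in> T" for s j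
        using t[OF s] c[of j] s TR by (auto simp: Pi_iff)
      have GR: "G j \<in> carrier R" for j unfolding G_def using cl by auto
      have G_eq: "G j = (\<Oplus>s\<in>T. c j s \<otimes> s) \<oplus> x \<otimes> G (Suc j)" for j
      proof -
        have "G j = (\<Oplus>s\<in>T. c j s \<otimes> s \<oplus> x \<otimes> (t s (Suc j) \<otimes> s))"
          unfolding G_def
        proof (rule R.finsum_cong')
          fix s assume s: "s \<in> T"
          then have "s \<in> carrier R" "c j s \<in> carrier R" "t s (Suc j) \<in> carrier R"
            using TR c[of j] t[OF s] by auto
          then show "t s j \<otimes> s = c j s \<otimes> s \<oplus> x \<otimes> (t s (Suc j) \<otimes> s)"
            unfolding t_eq[OF s, of j] using x by (simp add: R.l_distr R.m_assoc)
        qed (use cl x in auto)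
        also have "\<dots> = (\<Oplus>s\<in>T. c j s \<otimes> s) \<oplus> (\<Oplus>s\<in>T. x \<otimes> (t s (Suc j) \<otimes> s))"
          using cl x by (intro R.finsum_addf) auto
        also have "(\<Oplus>s\<in>T. x \<otimes> (t s (Suc j) \<otimes> s)) = x \<otimes> G (Suc j)"
          unfolding G_def using cl x T(2) by (simp add: R.finsum_rdistr)
        finally show ?thesis .
      qed
      \<comment> \<open>The combinations of \<open>T\<close> cancel in the two recursions, so the
        differences satisfy d_j = x d_{j+1} and separatedness applies.\<close>
      have "F 0 \<ominus> G 0 = \<zero>"
      proof (rule separated[of "\<lambda>j. F j \<ominus> G j"], safe)
        fix j
        define q where "q = (\<Oplus>s\<in>T. c j s \<otimes> s)"
        have q: "q \<in> carrier R" unfolding q_def using cl by auto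
        have "F j \<ominus> G j = (q \<oplus> x \<otimes> F (Suc j)) \<ominus> (q \<oplus> x \<otimes> G (Suc j))"
          unfolding q_def using Fc G_eq by metis
        also have "\<dots> = x \<otimes> F (Suc j) \<ominus> x \<otimes> G (Suc j)"
          using FR[of "Suc j"] GR[of "Suc j"] x q
          by (simp add: R.minus_eq R.minus_add R.a_ac R.r_neg1 R.r_neg2 R.r_neg)
        finally have "F j \<ominus> G j = x \<otimes> F (Suc j) \<ominus> x \<otimes> G (Suc j)" .
        then show "F j \<ominus> G j = x \<otimes> (F (Suc j) \<ominus> G (Suc j))"
          using FR GR x by (simp add: R.minus_eq R.r_distr R.r_minus)
      qed (use FR GR in auto)
      then have "f0 = G 0" using FR GR F(2) by (metis R.r_right_minus_eq)
      moreover have "G 0 \<in> Idl T"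
      proof -
        interpret T: ideal "Idl T" R by (rule R.genideal_ideal[OF TR])
        have "(\<Oplus>s\<in>U. t s 0 \<otimes> s) \<in> Idl T" if "finite U" "U \<subseteq> T" for U
          using that
        proof (induction U)
          case (insert u U)
          moreover have "(\<lambda>s. t s 0 \<otimes> s) \<in> insert u U \<rightarrow> carrier R" using cl(1) insert(4) by auto
          moreover have "t u 0 \<otimes> u \<in> Idl T"
            using t[of u] R.genideal_self[OF TR] insert(4) by (intro T.I_l_closed) auto
          ultimately show ?case by auto
        qed auto
        then show ?thesis using T(2) by (auto simp: G_def)
      qed
      ultimately show "f0 \<in> Idl T" by simp
    qed
  qed

  have descend: "\<exists>A\<subseteq>carrier R. finite A \<and> J k = Idl A"
    if fg: "\<exists>A\<subseteq>carrier R. finite A \<and> J (Suc k) = Idl A" for k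
  proof -
    obtain A where A: "A \<subseteq> carrier R" "finite A" "J (Suc k) = Idl A" using fg by blast
    obtain T where T: "T \<subseteq> J k" "finite T" "h ` J k = Idl\<^bsub>S\<^esub> (h ` T)" using lift[OF J] by blast
    have TR: "T \<subseteq> carrier R" using T(1) ideal.Icarr[OF J] by blast
    \<comment> \<open>This \<open>T\<close> belongs to level \<open>k\<close> and hides the earlier
      one; \<open>A\<close> generates the next level, and \<open>x\<close> carries it into
      \<open>J k\<close>.\<close>
    define U where "U = T \<union> (\<otimes>) x ` A"
    have UR: "U \<subseteq> carrier R" using TR A(1) x by (auto simp: U_def)
    interpret U: ideal "Idl U" R by (rule R.genideal_ideal[OF UR])
    have "A \<subseteq> J (Suc k)" using R.genideal_self A by blast
    then have "U \<subseteq> J k" using T(1) by (auto simp: U_def JS R.colon_def)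
    then have "Idl U \<subseteq> J k" by (rule R.genideal_minimal[OF J])
    moreover have "J k \<subseteq> Idl U"
    proof
      fix f assume f: "f \<in> J k"
      then have "h f \<in> Idl\<^bsub>S\<^esub> (h ` T)" using T(3) by blast
      then obtain g f' where g: "g \<in> Idl T" and f': "f' \<in> Idl A" and eq: "f = g \<oplus> x \<otimes> f'"
        using split[OF J T(1) f] unfolding A(3)[symmetric] JS by blast
      \<comment> \<open>Comparing ideals avoids expanding \<open>f'\<close> in the generators
        \<open>A\<close>: it suffices that \<open>A\<close> itself lies in (Idl U : x).\<close>
      have "Idl A \<subseteq> R.colon (Idl U) x"
        using R.genideal_self[OF UR] A(1)
        by (intro R.genideal_minimal R.ideal_colon U.ideal_axioms x) (auto simp: R.colon_def U_def)
      with f' have xf': "x \<otimes> f' \<in> Idl U" by (auto simp: R.colon_def)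
      have "g \<in> Idl U"
        using g R.subset_Idl_subset[OF UR, of T] by (auto simp: U_def)
      then show "f \<in> Idl U" unfolding eq using xf' by (rule U.a_closed)
    qed
    ultimately show ?thesis using UR A(2) T(2) by (intro exI[of _ U]) (auto simp: U_def)
  qed
  have "\<exists>A\<subseteq>carrier R. finite A \<and> J 0 = Idl A"
  \<comment> \<open>Downward induction from \<open>N\<close>, where \<open>T\<close> generates, to
    0.\<close>
  proof (rule inc_induct[of 0 N "\<lambda>k. \<exists>A\<subseteq>carrier R. finite A \<and> J k = Idl A"])
    show "\<exists>A\<subseteq>carrier R. finite A \<and> J N = Idl A" using top TR T(2) by blast
  qed (use descend in auto)
  then show "\<exists>A\<subseteq>carrier R. finite A \<and> I = Idl A" by (simp add: J0)
qed

section \<open>Multivariate power series\<close>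

text \<open>\<open>Sigma I A\<close> is the disjoint union of its fibres. Read in the additive
  monoid, this interchanges the two sums in the associativity of the Cauchy product.\<close>

lemma (in comm_monoid) finprod_Sigma:
  assumes "finite I" and "\<And>i. i \<in> I \<Longrightarrow> finite (A i)" and "g \<in> Sigma I A \<rightarrow> carrier G"
  shows "(\<Otimes>i\<in>I. \<Otimes>j\<in>A i. g (i, j)) = (\<Otimes>p\<in>Sigma I A. g p)"
proof -
  have S: "Sigma I A = (\<Union>i\<in>I. Pair i ` A i)" by auto
  have "(\<Otimes>p\<in>Sigma I A. g p) = (\<Otimes>i\<in>I. \<Otimes>p\<in>Pair i ` A i. g p)"
    unfolding S using assms
    by (intro finprod_UN_disjoint) (auto simp: pairwise_def disjnt_def)
  also have "\<dots> = (\<Otimes>i\<in>I. \<Otimes>j\<in>A i. g (i, j))"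
    using assms by (intro finprod_cong' finprod_reindex) (auto simp: inj_on_def intro!: finprod_closed)
  finally show ?thesis ..
qed

text \<open>A submultiset of \<open>add_mset a m\<close> either contains \<open>a\<close>, and
  removing one copy leaves a submultiset of \<open>m\<close>, or avoids \<open>a\<close> and is
  already one. This makes every Cauchy sum finite.\<close>

lemma finite_submultisets: "finite {k. k \<subseteq># m}"
proof (induction m)
  case (add a m)
  have "{k. k \<subseteq># add_mset a m} \<subseteq> {k. k \<subseteq># m} \<union> add_mset a ` {k. k \<subseteq># m}"
  proof
    fix k assume k: "k \<in> {k. k \<subseteq># add_mset a m}"
    show "k \<in> {k. k \<subseteq># m} \<union> add_mset a ` {k. k \<subseteq># m}"
    proof (cases "a \<in># k")
      case True
      then obtain l where "k = add_mset a l" by (metis insert_DiffM)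
      with k show ?thesis by auto
    next
      case False
      have "count k b \<le> count m b" for b
        using mset_subset_eq_count[of k "add_mset a m" b] k False
        by (cases "b = a") (auto simp: not_in_iff)
      then show ?thesis by (simp add: subseteq_mset_def)
    qed
  qed
  then show ?case using add.IH finite_subset by blast
qed simp

section \<open>Monomials and coefficients of power series\<close>

lemma empty_in_monomials [simp]: "{#} \<in> monomials n"
  by (simp add: monomials_def)

lemma monomials_subset_mset: "m \<in> monomials n \<Longrightarrow> k \<subseteq># m \<Longrightarrow> k \<in> monomials n"
  by (auto simp: monomials_def dest: set_mset_mono)

lemma diff_in_monomials [simp]: "m \<in> monomials n \<Longrightarrow> m - k \<in> monomials n"
  by (rule monomials_subset_mset) auto

lemma monomials_Suc_iff: "m \<in> monomials n \<longleftrightarrow> m \<in> monomials (Suc n) \<and> Suc n \<notin># m"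
  by (auto simp: monomials_def atLeastAtMostSuc_conv)

text \<open>The monomial x^c as a series. For \<open>c\<close> outside \<open>monomials n\<close> it
  is the zero series.\<close>

definition mfps_monom :: "('a, 'b) ring_scheme \<Rightarrow> nat \<Rightarrow> nat multiset \<Rightarrow> nat multiset \<Rightarrow> 'a"
  where "mfps_monom A n c = (\<lambda>m\<in>monomials n. if m = c then \<one>\<^bsub>A\<^esub> else \<zero>\<^bsub>A\<^esub>)"

lemma mfps_one: "\<one>\<^bsub>mfps_ring A n\<^esub> = mfps_monom A n {#}"
  by (simp add: mfps_ring_def mfps_monom_def)

lemma mfps_carrier: "carrier (mfps_ring A n) = monomials n \<rightarrow>\<^sub>E carrier A"
  by (simp add: mfps_ring_def)

lemma mfps_zero: "m \<in> monomials n \<Longrightarrow> \<zero>\<^bsub>mfps_ring A n\<^esub> m = \<zero>\<^bsub>A\<^esub>"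
  by (simp add: mfps_ring_def)

lemma mfps_add: "m \<in> monomials n \<Longrightarrow> (f \<oplus>\<^bsub>mfps_ring A n\<^esub> g) m = f m \<oplus>\<^bsub>A\<^esub> g m"
  by (simp add: mfps_ring_def)

lemma mfps_mult:
  "m \<in> monomials n \<Longrightarrow> (f \<otimes>\<^bsub>mfps_ring A n\<^esub> g) m = (\<Oplus>\<^bsub>A\<^esub>k\<in>{k. k \<subseteq># m}. f k \<otimes>\<^bsub>A\<^esub> g (m - k))"
  by (simp add: mfps_ring_def)

lemma mfps_eqI:
  assumes "f \<in> carrier (mfps_ring A n)" "g \<in> carrier (mfps_ring A n)"
    and "\<And>m. m \<in> monomials n \<Longrightarrow> f m = g m"
  shows "f = g"
  using assms unfolding mfps_carrier by (rule PiE_ext)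

lemma mfps_coeff: "f \<in> carrier (mfps_ring A n) \<Longrightarrow> m \<in> monomials n \<Longrightarrow> f m \<in> carrier A"
  by (auto simp: mfps_carrier)

section \<open>The commutative ring axioms for the Cauchy product\<close>

context cring
begin

lemma mfps_prod_coeff:
  assumes "f \<in> carrier (mfps_ring R n)" "g \<in> carrier (mfps_ring R n)" "m \<in> monomials n" "k \<subseteq># m"
  shows "f k \<otimes> g (m - k) \<in> carrier R"
  using assms by (intro m_closed mfps_coeff[of _ R n]) (auto intro: monomials_subset_mset)

lemma mfps_zero_closed: "\<zero>\<^bsub>mfps_ring R n\<^esub> \<in> carrier (mfps_ring R n)"
  by (simp add: mfps_ring_def)

lemma mfps_add_closed:
  assumes "f \<in> carrier (mfps_ring R n)" "g \<in> carrier (mfps_ring R n)"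
  shows "f \<oplus>\<^bsub>mfps_ring R n\<^esub> g \<in> carrier (mfps_ring R n)"
  using assms by (auto simp: mfps_ring_def)

lemma mfps_mult_closed:
  assumes "f \<in> carrier (mfps_ring R n)" "g \<in> carrier (mfps_ring R n)"
  shows "f \<otimes>\<^bsub>mfps_ring R n\<^esub> g \<in> carrier (mfps_ring R n)"
proof -
  have "(\<Oplus>k\<in>{k. k \<subseteq># m}. f k \<otimes> g (m - k)) \<in> carrier R" if "m \<in> monomials n" for m
    using mfps_prod_coeff[OF assms that] by (intro finsum_closed) auto
  then show ?thesis by (auto simp: mfps_ring_def)
qed

lemma mfps_monom_closed: "mfps_monom R n c \<in> carrier (mfps_ring R n)"
  by (auto simp: mfps_monom_def mfps_carrier)

text \<open>Only the term \<open>k = c\<close> of the Cauchy sum survives, so multiplying by a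
  monomial shifts coefficients.\<close>

lemma mfps_monom_mult:
  assumes f: "f \<in> carrier (mfps_ring R n)" and m: "m \<in> monomials n"
  shows "(mfps_monom R n c \<otimes>\<^bsub>mfps_ring R n\<^esub> f) m = (if c \<subseteq># m then f (m - c) else \<zero>)"
proof -
  have fk: "f (m - k) \<in> carrier R" for k using mfps_coeff[OF f] m by simp
  have "(mfps_monom R n c \<otimes>\<^bsub>mfps_ring R n\<^esub> f) m
      = (\<Oplus>k\<in>{k. k \<subseteq># m}. if c = k then f (m - k) else \<zero>)"
    unfolding mfps_mult[OF m] using fk monomials_subset_mset[OF m]
    by (intro finsum_cong') (auto simp: mfps_monom_def)
  also have "\<dots> = (if c \<subseteq># m then f (m - c) else \<zero>)"
  proof (cases "c \<subseteq># m")
    case True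
    then show ?thesis
      using finsum_singleton[of c "{k. k \<subseteq># m}" "\<lambda>k. f (m - k)"] fk finite_submultisets[of m] by simp
  next
    case False
    then show ?thesis by (auto intro!: add.finprod_one_eqI)
  qed
  finally show ?thesis .
qed

text \<open>Passing from \<open>k\<close> to the complementary factor \<open>m - k\<close> is an
  involution on the divisors of \<open>m\<close>.\<close>

lemma mfps_mult_comm:
  assumes f: "f \<in> carrier (mfps_ring R n)" and g: "g \<in> carrier (mfps_ring R n)"
  shows "f \<otimes>\<^bsub>mfps_ring R n\<^esub> g = g \<otimes>\<^bsub>mfps_ring R n\<^esub> f"
proof (rule mfps_eqI[of _ R n])
  fix m assume m: "m \<in> monomials n"
  have dd: "m - (m - k) = k" if "k \<subseteq># m" for k
    using that by (simp add: multiset_eq_iff subseteq_mset_def)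
  then have inv: "(-) m ` {k. k \<subseteq># m} = {k. k \<subseteq># m}"
    by (auto simp: image_iff) (metis diff_subset_eq_self)
  have "(f \<otimes>\<^bsub>mfps_ring R n\<^esub> g) m = (\<Oplus>k\<in>(-) m ` {k. k \<subseteq># m}. f k \<otimes> g (m - k))"
    by (simp only: inv mfps_mult[OF m])
  also have "\<dots> = (\<Oplus>k\<in>{k. k \<subseteq># m}. f (m - k) \<otimes> g (m - (m - k)))"
  proof (rule finsum_reindex)
    show "(\<lambda>k. f k \<otimes> g (m - k)) \<in> (-) m ` {k. k \<subseteq># m} \<rightarrow> carrier R"
      unfolding inv using mfps_prod_coeff[OF f g m] by auto
    show "inj_on ((-) m) {k. k \<subseteq># m}"
      by (rule inj_on_inverseI[of _ "(-) m"]) (simp add: dd)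
  qed
  also have "\<dots> = (\<Oplus>k\<in>{k. k \<subseteq># m}. g k \<otimes> f (m - k))"
  proof (rule finsum_cong')
    fix k assume "k \<in> {k. k \<subseteq># m}"
    then have "m - (m - k) = k" "k \<in> monomials n" using dd monomials_subset_mset[OF m] by auto
    then show "f (m - k) \<otimes> g (m - (m - k)) = g k \<otimes> f (m - k)"
      using mfps_coeff[OF f] mfps_coeff[OF g] m by (simp add: m_comm)
  qed (use mfps_prod_coeff[OF g f m] in auto)
  also have "\<dots> = (g \<otimes>\<^bsub>mfps_ring R n\<^esub> f) m" by (simp add: mfps_mult[OF m])
  finally show "(f \<otimes>\<^bsub>mfps_ring R n\<^esub> g) m = (g \<otimes>\<^bsub>mfps_ring R n\<^esub> f) m" .
qed (use f g in \<open>auto intro: mfps_mult_closed\<close>)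

text \<open>Both bracketings sum over the factorizations of \<open>m\<close> into three monomials;
  only the indexing of these differs.\<close>

lemma mfps_mult_assoc:
  assumes f: "f \<in> carrier (mfps_ring R n)" and g: "g \<in> carrier (mfps_ring R n)"
    and h: "h \<in> carrier (mfps_ring R n)"
  shows "(f \<otimes>\<^bsub>mfps_ring R n\<^esub> g) \<otimes>\<^bsub>mfps_ring R n\<^esub> h = f \<otimes>\<^bsub>mfps_ring R n\<^esub> (g \<otimes>\<^bsub>mfps_ring R n\<^esub> h)"
proof (rule mfps_eqI[of _ R n])
  fix m assume m: "m \<in> monomials n"
  note D = monomials_subset_mset[OF m]
  let ?D = "\<lambda>m :: nat multiset. {k. k \<subseteq># m}"
  \<comment> \<open>In \<open>\<tau>\<close>, \<open>k\<close> is the product of the first two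
    factors and \<open>j\<close> the first. The other bracketing is indexed by the first factor
    \<open>j\<close> and the second \<open>l\<close>, and \<open>\<sigma>\<close>
    translates.\<close>
  define \<tau> where "\<tau> = (\<lambda>(k, j). (f j \<otimes> g (k - j)) \<otimes> h (m - k))"
  define \<sigma> :: "nat multiset \<times> nat multiset \<Rightarrow> _" where "\<sigma> = (\<lambda>(j, l). (j + l, j))"
  have \<tau>: "\<tau> \<in> Sigma (?D m) ?D \<rightarrow> carrier R"
    using mfps_prod_coeff[OF f g] mfps_coeff[OF h] m D by (auto simp: \<tau>_def)
  have "((f \<otimes>\<^bsub>mfps_ring R n\<^esub> g) \<otimes>\<^bsub>mfps_ring R n\<^esub> h) m = (\<Oplus>k\<in>?D m. \<Oplus>j\<in>?D k. \<tau> (k, j))"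
    unfolding mfps_mult[OF m]
  proof (rule finsum_cong')
    fix k assume k: "k \<in> ?D m"
    show "(f \<otimes>\<^bsub>mfps_ring R n\<^esub> g) k \<otimes> h (m - k) = (\<Oplus>j\<in>?D k. \<tau> (k, j))"
      unfolding \<tau>_def using mfps_prod_coeff[OF f g D[of k]] mfps_coeff[OF h] m k
      by (simp add: mfps_mult[OF D] finsum_ldistr finite_submultisets Pi_def)
  qed (use \<tau> in \<open>auto intro!: finsum_closed\<close>)
  also have "\<dots> = (\<Oplus>p\<in>Sigma (?D m) ?D. \<tau> p)"
    using \<tau> by (intro add.finprod_Sigma finite_submultisets) auto
  also have "Sigma (?D m) ?D = \<sigma> ` Sigma (?D m) (\<lambda>j. ?D (m - j))"
  proof (safe)
    fix k j assume "k \<subseteq># m" "j \<subseteq># k"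
    then show "(k, j) \<in> \<sigma> ` Sigma (?D m) (\<lambda>j. ?D (m - j))"
      by (intro image_eqI[of _ _ "(j, k - j)"])
        (auto simp: \<sigma>_def subseteq_mset_def multiset_eq_iff intro: order_trans diff_le_mono)
  next
    fix k j j' l assume "j' \<subseteq># m" "l \<subseteq># m - j'" "(k, j) = \<sigma> (j', l)"
    then show "k \<subseteq># m" "j \<subseteq># k" 
      by (auto simp: \<sigma>_def subset_mset.le_diff_conv2 add.commute)
  qed
  also have "(\<Oplus>p\<in>\<dots>. \<tau> p) = (\<Oplus>p\<in>Sigma (?D m) (\<lambda>j. ?D (m - j)). \<tau> (\<sigma> p))"
  proof (rule finsum_reindex)
    show "\<tau> \<in> \<sigma> ` Sigma (?D m) (\<lambda>j. ?D (m - j)) \<rightarrow> carrier R"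
      using \<tau> by (auto simp: \<sigma>_def subset_mset.le_diff_conv2 add.commute)
    show "inj_on \<sigma> (Sigma (?D m) (\<lambda>j. ?D (m - j)))"
      by (auto simp: inj_on_def \<sigma>_def)
  qed
  also have "\<dots> = (\<Oplus>j\<in>?D m. \<Oplus>l\<in>?D (m - j). \<tau> (\<sigma> (j, l)))"
    using \<tau> by (intro add.finprod_Sigma[symmetric] finite_submultisets)
      (auto simp: \<sigma>_def subset_mset.le_diff_conv2 add.commute)
  also have "\<dots> = (f \<otimes>\<^bsub>mfps_ring R n\<^esub> (g \<otimes>\<^bsub>mfps_ring R n\<^esub> h)) m"
    unfolding mfps_mult[OF m]
  proof (rule finsum_cong')
    fix j assume j: "j \<in> ?D m"
    have mj: "m - j \<in> monomials n" using m by simp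
    have "(\<Oplus>l\<in>?D (m - j). \<tau> (\<sigma> (j, l))) = (\<Oplus>l\<in>?D (m - j). f j \<otimes> (g l \<otimes> h (m - j - l)))"
    proof (rule finsum_cong')
      fix l assume l: "l \<in> ?D (m - j)"
      have "f j \<in> carrier R" "g l \<in> carrier R" "h (m - j - l) \<in> carrier R"
        using mfps_coeff[OF f D, of j] mfps_coeff[OF g, of l] mfps_coeff[OF h] j l m
          monomials_subset_mset[OF mj] by auto
      then show "\<tau> (\<sigma> (j, l)) = f j \<otimes> (g l \<otimes> h (m - j - l))"
        by (simp add: \<tau>_def \<sigma>_def m_assoc)
    qed (use mfps_prod_coeff[OF g h mj] mfps_coeff[OF f D] j in auto)
    also have "\<dots> = f j \<otimes> (g \<otimes>\<^bsub>mfps_ring R n\<^esub> h) (m - j)"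
      unfolding mfps_mult[OF mj] using mfps_prod_coeff[OF g h mj] mfps_coeff[OF f D] j
      by (intro finsum_rdistr[symmetric] finite_submultisets) auto
    finally show "(\<Oplus>l\<in>?D (m - j). \<tau> (\<sigma> (j, l))) = f j \<otimes> (g \<otimes>\<^bsub>mfps_ring R n\<^esub> h) (m - j)" .
  qed (use mfps_prod_coeff[OF f mfps_mult_closed[OF g h] m] in auto)
  finally show "((f \<otimes>\<^bsub>mfps_ring R n\<^esub> g) \<otimes>\<^bsub>mfps_ring R n\<^esub> h) m
      = (f \<otimes>\<^bsub>mfps_ring R n\<^esub> (g \<otimes>\<^bsub>mfps_ring R n\<^esub> h)) m" .
qed (use assms in \<open>auto intro: mfps_mult_closed\<close>)

lemma cring_mfps_ring: "cring (mfps_ring R n)"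
proof (rule cringI)
  note closed = mfps_add_closed mfps_mult_closed mfps_zero_closed
  show "abelian_group (mfps_ring R n)"
  proof (rule abelian_groupI)
    fix f g h assume fgh: "f \<in> carrier (mfps_ring R n)" "g \<in> carrier (mfps_ring R n)"
      "h \<in> carrier (mfps_ring R n)"
    then show "f \<oplus>\<^bsub>mfps_ring R n\<^esub> g \<oplus>\<^bsub>mfps_ring R n\<^esub> h = f \<oplus>\<^bsub>mfps_ring R n\<^esub> (g \<oplus>\<^bsub>mfps_ring R n\<^esub> h)"
      by (intro mfps_eqI[of _ R n] closed) (auto simp: mfps_add a_assoc mfps_coeff)
  next
    fix f g assume "f \<in> carrier (mfps_ring R n)" "g \<in> carrier (mfps_ring R n)"
    then show "f \<oplus>\<^bsub>mfps_ring R n\<^esub> g = g \<oplus>\<^bsub>mfps_ring R n\<^esub> f"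
      by (intro mfps_eqI[of _ R n] closed) (auto simp: mfps_add a_comm mfps_coeff)
  next
    fix f assume f: "f \<in> carrier (mfps_ring R n)"
    then show "\<zero>\<^bsub>mfps_ring R n\<^esub> \<oplus>\<^bsub>mfps_ring R n\<^esub> f = f"
      by (intro mfps_eqI[of _ R n] closed) (auto simp: mfps_add mfps_zero mfps_coeff)
    have "(\<lambda>m\<in>monomials n. \<ominus> f m) \<in> carrier (mfps_ring R n)"
      using f by (auto simp: mfps_carrier)
    moreover from this have "(\<lambda>m\<in>monomials n. \<ominus> f m) \<oplus>\<^bsub>mfps_ring R n\<^esub> f = \<zero>\<^bsub>mfps_ring R n\<^esub>"
      using f by (intro mfps_eqI[of _ R n] closed) (auto simp: mfps_add mfps_zero mfps_coeff l_neg)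
    ultimately show "\<exists>g\<in>carrier (mfps_ring R n). g \<oplus>\<^bsub>mfps_ring R n\<^esub> f = \<zero>\<^bsub>mfps_ring R n\<^esub>" by blast
  qed (auto intro: closed)
  show "comm_monoid (mfps_ring R n)"
  proof (rule comm_monoidI)
    fix f assume "f \<in> carrier (mfps_ring R n)"
    then show "\<one>\<^bsub>mfps_ring R n\<^esub> \<otimes>\<^bsub>mfps_ring R n\<^esub> f = f"
      unfolding mfps_one
      by (intro mfps_eqI[of _ R n] closed mfps_monom_closed) (auto simp: mfps_monom_mult)
  qed (auto intro: closed mfps_mult_comm mfps_mult_assoc simp: mfps_one mfps_monom_closed)
  fix f g h assume fgh: "f \<in> carrier (mfps_ring R n)" "g \<in> carrier (mfps_ring R n)"
    "h \<in> carrier (mfps_ring R n)"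
  show "(f \<oplus>\<^bsub>mfps_ring R n\<^esub> g) \<otimes>\<^bsub>mfps_ring R n\<^esub> h
      = f \<otimes>\<^bsub>mfps_ring R n\<^esub> h \<oplus>\<^bsub>mfps_ring R n\<^esub> g \<otimes>\<^bsub>mfps_ring R n\<^esub> h"
  proof (rule mfps_eqI[of _ R n])
    fix m assume m: "m \<in> monomials n"
    note D = monomials_subset_mset[OF m]
    have "((f \<oplus>\<^bsub>mfps_ring R n\<^esub> g) \<otimes>\<^bsub>mfps_ring R n\<^esub> h) m
        = (\<Oplus>k\<in>{k. k \<subseteq># m}. f k \<otimes> h (m - k) \<oplus> g k \<otimes> h (m - k))"
      unfolding mfps_mult[OF m] using fgh m D mfps_prod_coeff[OF _ fgh(3) m]
      by (intro finsum_cong') (auto simp: mfps_add mfps_coeff l_distr)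
    also have "\<dots> = (f \<otimes>\<^bsub>mfps_ring R n\<^esub> h \<oplus>\<^bsub>mfps_ring R n\<^esub> g \<otimes>\<^bsub>mfps_ring R n\<^esub> h) m"
      unfolding mfps_add[OF m] mfps_mult[OF m]
      using mfps_prod_coeff[OF _ fgh(3) m] fgh by (intro finsum_addf) auto
    finally show "((f \<oplus>\<^bsub>mfps_ring R n\<^esub> g) \<otimes>\<^bsub>mfps_ring R n\<^esub> h) m
      = (f \<otimes>\<^bsub>mfps_ring R n\<^esub> h \<oplus>\<^bsub>mfps_ring R n\<^esub> g \<otimes>\<^bsub>mfps_ring R n\<^esub> h) m" .
  qed (use fgh in \<open>auto intro!: closed\<close>)
qed

end

section \<open>Induction on the number of variables\<close>

context cring
begin

text \<open>This is the substitution of 0 for the last variable. It respects products because every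
  divisor of a monomial free of that variable is free of it too.\<close>

lemma ring_hom_cring_restrict_monomials:
  "ring_hom_cring (mfps_ring R (Suc n)) (mfps_ring R n) (\<lambda>f. restrict f (monomials n))"
proof (intro ring_hom_cringI ring_hom_memI)
  have sub: "m \<in> monomials (Suc n)" if "m \<in> monomials n" for m
    using that monomials_Suc_iff by blast
  show "restrict f (monomials n) \<in> carrier (mfps_ring R n)"
    if "f \<in> carrier (mfps_ring R (Suc n))" for f
    using that sub by (auto simp: mfps_carrier)
  show "restrict (f \<otimes>\<^bsub>mfps_ring R (Suc n)\<^esub> g) (monomials n)
      = restrict f (monomials n) \<otimes>\<^bsub>mfps_ring R n\<^esub> restrict g (monomials n)"
    if fg: "f \<in> carrier (mfps_ring R (Suc n))" "g \<in> carrier (mfps_ring R (Suc n))" for f g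
  proof (rule ext)
    fix m
    show "restrict (f \<otimes>\<^bsub>mfps_ring R (Suc n)\<^esub> g) (monomials n) m
      = (restrict f (monomials n) \<otimes>\<^bsub>mfps_ring R n\<^esub> restrict g (monomials n)) m"
    proof (cases "m \<in> monomials n")
      case True
      then show ?thesis
        using mfps_prod_coeff[OF fg sub[OF True]] monomials_subset_mset[OF True]
        by (auto simp: mfps_mult sub intro!: finsum_cong')
    next
      case False
      then show ?thesis by (simp add: mfps_ring_def)
    qed
  qed
  show "restrict (f \<oplus>\<^bsub>mfps_ring R (Suc n)\<^esub> g) (monomials n)
      = restrict f (monomials n) \<oplus>\<^bsub>mfps_ring R n\<^esub> restrict g (monomials n)" for f g
    using sub by (auto simp: mfps_ring_def fun_eq_iff)
  show "restrict \<one>\<^bsub>mfps_ring R (Suc n)\<^esub> (monomials n) = \<one>\<^bsub>mfps_ring R n\<^esub>"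
    using sub by (auto simp: mfps_ring_def fun_eq_iff)
qed (rule cring_mfps_ring)+

text \<open>The constant coefficient identifies the ring in no variables with \<open>R\<close>. The
  criterion with \<open>x\<close> zero transfers the property: the kernel is trivial, and the
  recursions reduce to t_j = a_j and d_j = 0.\<close>

lemma noetherian_mfps_ring_0:
  assumes "noetherian_ring R"
  shows "noetherian_ring (mfps_ring R 0)"
proof -
  interpret P: cring "mfps_ring R 0" by (rule cring_mfps_ring)
  have mon: "monomials 0 = {{#}}" by (auto simp: monomials_def)
  have sub: "{k. k \<subseteq># {#}} = {{#} :: nat multiset}" by auto
  interpret H: ring_hom_cring "mfps_ring R 0" R "\<lambda>f. f {#}"
    by (intro ring_hom_cringI ring_hom_memI)
      (auto simp: mfps_coeff mfps_add mfps_mult sub mfps_one mfps_monom_def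
        P.cring_axioms cring_axioms)
  show ?thesis
  proof (rule H.noetherian_ring_adically_complete[OF assms, of "\<zero>\<^bsub>mfps_ring R 0\<^esub>"])
    have "a \<in> (\<lambda>f. f {#}) ` carrier (mfps_ring R 0)" if "a \<in> carrier R" for a
      using that by (intro image_eqI[of _ _ "\<lambda>m\<in>monomials 0. a"]) (auto simp: mfps_carrier)
    then show "(\<lambda>f. f {#}) ` carrier (mfps_ring R 0) = carrier R"
      using H.hom_closed by auto
  next
    fix f assume f: "f \<in> carrier (mfps_ring R 0)" "f {#} = \<zero>"
    then have "f = \<zero>\<^bsub>mfps_ring R 0\<^esub>"
      by (intro mfps_eqI[of _ R 0]) (auto simp: mon mfps_zero)
    then show "\<exists>g\<in>carrier (mfps_ring R 0). f = \<zero>\<^bsub>mfps_ring R 0\<^esub> \<otimes>\<^bsub>mfps_ring R 0\<^esub> g"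
      using P.zero_closed P.l_null by metis
  next
    fix a :: "nat \<Rightarrow> nat multiset \<Rightarrow> 'a" assume "a \<in> UNIV \<rightarrow> carrier (mfps_ring R 0)"
    then show "\<exists>t\<in>UNIV \<rightarrow> carrier (mfps_ring R 0).
        \<forall>j. t j = a j \<oplus>\<^bsub>mfps_ring R 0\<^esub> \<zero>\<^bsub>mfps_ring R 0\<^esub> \<otimes>\<^bsub>mfps_ring R 0\<^esub> t (Suc j)"
      by (intro bexI[of _ a]) (auto simp: Pi_iff)
  next
    fix d :: "nat \<Rightarrow> nat multiset \<Rightarrow> 'a" assume dP: "d \<in> UNIV \<rightarrow> carrier (mfps_ring R 0)"
      and d: "\<forall>j. d j = \<zero>\<^bsub>mfps_ring R 0\<^esub> \<otimes>\<^bsub>mfps_ring R 0\<^esub> d (Suc j)"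
    have "d (Suc 0) \<in> carrier (mfps_ring R 0)" using dP by auto
    then show "d 0 = \<zero>\<^bsub>mfps_ring R 0\<^esub>" using d P.l_null by metis
  qed simp
qed

text \<open>The criterion is applied with \<open>x\<close> the last variable, multiplication by
  which shifts coefficients.\<close>

lemma noetherian_mfps_ring_Suc:
  assumes noeth: "noetherian_ring (mfps_ring R n)"
  shows "noetherian_ring (mfps_ring R (Suc n))"
proof -
  define P where "P = mfps_ring R (Suc n)"
  define x where "x = mfps_monom R (Suc n) {#Suc n#}"
  have x: "x \<in> carrier P" unfolding x_def P_def by (rule mfps_monom_closed)
  have x_mult: "(x \<otimes>\<^bsub>P\<^esub> f) m = (if Suc n \<in># m then f (m - {#Suc n#}) else \<zero>)"
    if "f \<in> carrier P" "m \<in> monomials (Suc n)" for f m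
    using that by (simp add: x_def P_def mfps_monom_mult)
  interpret P: cring P unfolding P_def by (rule cring_mfps_ring)
  interpret H: ring_hom_cring P "mfps_ring R n" "\<lambda>f. restrict f (monomials n)"
    unfolding P_def by (rule ring_hom_cring_restrict_monomials)
  have P_eqI: "f = g" if "f \<in> carrier P" "g \<in> carrier P" "\<And>m. m \<in> monomials (Suc n) \<Longrightarrow> f m = g m" for f g
    using that mfps_eqI unfolding P_def by blast
  have coeff: "f m \<in> carrier R" if "f \<in> carrier P" "m \<in> monomials (Suc n)" for f m
    using that mfps_coeff unfolding P_def by blast
  have PI: "restrict f (monomials (Suc n)) \<in> carrier P"
    if "\<And>m. m \<in> monomials (Suc n) \<Longrightarrow> f m \<in> carrier R" for f
    using that by (auto simp: P_def mfps_carrier)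
  have "noetherian_ring P"
  proof (rule H.noetherian_ring_adically_complete[OF noeth _ x])
    have "f \<in> (\<lambda>f. restrict f (monomials n)) ` carrier P" if f: "f \<in> carrier (mfps_ring R n)" for f
    proof (rule image_eqI)
      \<comment> \<open>A preimage of \<open>f\<close>: extension by zero to the monomials divisible
        by the last variable.\<close>
      let ?F = "\<lambda>m\<in>monomials (Suc n). if m \<in> monomials n then f m else \<zero>"
      show F: "?F \<in> carrier P" using mfps_coeff[OF f] by (intro PI) auto
      show "f = restrict ?F (monomials n)"
      proof (rule mfps_eqI[OF f H.hom_closed[OF F]])
        fix m assume "m \<in> monomials n"
        then show "f m = restrict ?F (monomials n) m" using monomials_Suc_iff[of m n] by simp
      qed
    qed
    then show "(\<lambda>f. restrict f (monomials n)) ` carrier P = carrier (mfps_ring R n)"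
      using H.hom_closed by auto
  next
    fix f assume f: "f \<in> carrier P" and "restrict f (monomials n) = \<zero>\<^bsub>mfps_ring R n\<^esub>"
    then have f0: "f m = \<zero>" if "m \<in> monomials n" for m
      using that mfps_zero[OF that, of R] by (metis restrict_apply')
    \<comment> \<open>Division by the last variable, possible since \<open>f\<close> vanishes on all
      monomials not divisible by it.\<close>
    let ?g = "\<lambda>m\<in>monomials (Suc n). f (add_mset (Suc n) m)"
    have add: "add_mset (Suc n) m \<in> monomials (Suc n)" if "m \<in> monomials (Suc n)" for m
      using that by (auto simp: monomials_def)
    have g: "?g \<in> carrier P" using coeff[OF f] add by (intro PI) auto
    have "f = x \<otimes>\<^bsub>P\<^esub> ?g"
    proof (rule P_eqI)
      fix m assume m: "m \<in> monomials (Suc n)"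
      then show "f m = (x \<otimes>\<^bsub>P\<^esub> ?g) m"
        using f0[of m] by (auto simp: x_mult[OF g] monomials_Suc_iff[of m n])
    qed (use f g x in auto)
    with g show "\<exists>g\<in>carrier P. f = x \<otimes>\<^bsub>P\<^esub> g" by blast
  next
    fix a :: "nat \<Rightarrow> nat multiset \<Rightarrow> 'a" assume a: "a \<in> UNIV \<rightarrow> carrier P"
    \<comment> \<open>The coefficients of the infinite sum of x^i a_{j+i}. The i-th summand reaches
      \<open>m\<close> only if x^i divides it, which bounds i by the exponent of the last
      variable.\<close>
    define t where "t j = (\<lambda>m\<in>monomials (Suc n).
      \<Oplus>i\<in>{..count m (Suc n)}. a (j + i) (m - replicate_mset i (Suc n)))" for j
    have ac: "a j m \<in> carrier R" if "m \<in> monomials (Suc n)" for j m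
      using a coeff that by auto
    have t: "t j \<in> carrier P" for j
      unfolding t_def using ac by (intro PI finsum_closed) auto
    have "t j = a j \<oplus>\<^bsub>P\<^esub> x \<otimes>\<^bsub>P\<^esub> t (Suc j)" for j
    proof (rule P_eqI)
      fix m assume m: "m \<in> monomials (Suc n)"
      have R: "(a j \<oplus>\<^bsub>P\<^esub> x \<otimes>\<^bsub>P\<^esub> t (Suc j)) m
          = a j m \<oplus> (if Suc n \<in># m then t (Suc j) (m - {#Suc n#}) else \<zero>)"
        using m x_mult[OF t m] by (simp add: P_def mfps_add)
      show "t j m = (a j \<oplus>\<^bsub>P\<^esub> x \<otimes>\<^bsub>P\<^esub> t (Suc j)) m"
      proof (cases "Suc n \<in># m")
        case True
        then obtain c where c: "count m (Suc n) = Suc c"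
          by (metis count_greater_zero_iff gr0_implies_Suc)
        have "t j m = (\<Oplus>i\<in>{..Suc c}. a (j + i) (m - replicate_mset i (Suc n)))"
          unfolding t_def restrict_apply'[OF m] c ..
        \<comment> \<open>The term i = 0 is \<open>a j m\<close>; in the others one factor
          \<open>x\<close> moves from the shift into the monomial, giving \<open>t (Suc j)\<close>
          at exponent \<open>c\<close>.\<close>
        also have "\<dots> = (\<Oplus>i\<in>{..c}. a (j + Suc i) (m - replicate_mset (Suc i) (Suc n))) \<oplus> a j m"
          using m ac by (subst finsum_Suc2) auto
        also have "\<dots> = a j m \<oplus> t (Suc j) (m - {#Suc n#})"
          using m ac by (subst a_comm) (auto simp: t_def c intro!: finsum_closed)
        finally show ?thesis using True R by simp
      next
        case False
        then have "count m (Suc n) = 0" by (simp add: not_in_iff)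
        then show ?thesis using False m ac R by (simp add: t_def)
      qed
    qed (use a t x in auto)
    then show "\<exists>t\<in>UNIV \<rightarrow> carrier P. \<forall>j. t j = a j \<oplus>\<^bsub>P\<^esub> x \<otimes>\<^bsub>P\<^esub> t (Suc j)"
      using t by (intro bexI[of _ t] allI funcsetI)
  next
    fix d :: "nat \<Rightarrow> nat multiset \<Rightarrow> 'a" assume d: "d \<in> UNIV \<rightarrow> carrier P"
      and eq: "\<forall>j. d j = x \<otimes>\<^bsub>P\<^esub> d (Suc j)"
    have dP: "d j \<in> carrier P" for j using d by auto
    \<comment> \<open>Each use of the recursion raises \<open>j\<close> and removes one copy of the
      last variable from \<open>m\<close>, hence induction on the size of \<open>m\<close> for all
      \<open>j\<close> at once.\<close>
    have "d j m = \<zero>" if "m \<in> monomials (Suc n)" for j m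
      using that
    proof (induction "size m" arbitrary: j m rule: less_induct)
      case less
      have "d j m = (if Suc n \<in># m then d (Suc j) (m - {#Suc n#}) else \<zero>)"
        using eq[rule_format, of j] x_mult[OF dP less.prems] by metis
      then show ?case using less.hyps less.prems by (auto simp: size_Diff1_less)
    qed
    then show "d 0 = \<zero>\<^bsub>P\<^esub>"
      by (intro P_eqI dP P.zero_closed) (auto simp: P_def mfps_zero)
  qed
  then show ?thesis by (simp add: P_def)
qed

lemma noetherian_mfps_ring:
  assumes "noetherian_ring R"
  shows "noetherian_ring (mfps_ring R n)"
  by (induction n) (auto intro: noetherian_mfps_ring_0 noetherian_mfps_ring_Suc assms)

end

theorem corollary1p2:
  fixes A :: "('a, 'b) ring_scheme" and n :: nat
  assumes "cring A" and "noetherian_ring A" and "n > 0"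
  shows "cring (mfps_ring A n) \<and> noetherian_ring (mfps_ring A n)"
  using cring.cring_mfps_ring cring.noetherian_mfps_ring assms by blast

end
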